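(* Let $g(z)=\sum_{n=0}^\infty b_n z^n$ be a power series with nonnegative coefficients such that, for some constants $B,L>0$ and $\beta,\lambda\ge0$ with $2\lambda<3\beta$, \[ B\,\frac{\beta^n}{n!}\le b_n\le L\,\frac{\lambda^n}{n!}\quad\text{for all } n\ge1. \] Then $f=e^g$ is in the Hayman class.
   Context: For a nonconstant power series $f(z)=\sum_{n\ge0}a_nz^n$ with $a_n\ge0$, $a_0>0$ and radius of convergence $R\in(0,\infty]$, its Khinchin family is the family of random variables $(X_t)_{t\in[0,R)}$ with values in $\{0,1,2,\dots\}$ given by $\mathbb P(X_t=n)=a_nt^n/f(t)$ for $t\in(0,R)$. Write $m(t)=\mathbb E(X_t)=tf'(t)/f(t)$, $\sigma^2(t)=\mathbb V(X_t)$, and $\breve X_t=(X_t-m(t))/\sigma(t)$. Such an $f$ is in the Hayman class if there is a function $h\colon[0,R)\to(0,\pi]$ such that: $\lim_{t\uparrow R}\sup_{|\theta|\le h(t)\sigma(t)}\big|\mathbb E(e^{i\theta\breve X_t})e^{\theta^2/2}-1\big|=0$; $\lim_{t\uparrow R}\sigma(t)\sup_{h(t)\sigma(t)\le|\theta|\le\pi\sigma(t)}|\mathbb E(e^{i\theta\breve X_t})|=0$; and $\lim_{t\uparrow R}\sigma(t)=\infty$. *)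

theory Defs
  imports "HOL-Probability.Probability" "HOL-Complex_Analysis.Laurent_Convergence"
begin

definition khinchin_series :: "real fps \<Rightarrow> bool" where
  "khinchin_series f \<longleftrightarrow>
     (\<forall>n. 0 \<le> fps_nth f n) \<and> 0 < fps_nth f 0 \<and> (\<exists>n>0. fps_nth f n \<noteq> 0) \<and>
     0 < fps_conv_radius f"

text \<open>
  The law of $X_t$. The weights form a probability distribution when \<^const>\<open>khinchin_series\<close>
  holds and $0 \le t < R$; with $0^0 = 1$ the formula gives the point mass at $0$ for $t = 0$.
\<close>
definition khinchin :: "real fps \<Rightarrow> real \<Rightarrow> nat pmf" where
  "khinchin f t = embed_pmf (\<lambda>n. fps_nth f n * t ^ n / eval_fps f t)"

definition khinchin_mean :: "real fps \<Rightarrow> real \<Rightarrow> real" where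
  "khinchin_mean f t = measure_pmf.expectation (khinchin f t) real"

definition khinchin_sd :: "real fps \<Rightarrow> real \<Rightarrow> real" where
  "khinchin_sd f t = sqrt (measure_pmf.variance (khinchin f t) real)"

definition khinchin_normalized :: "real fps \<Rightarrow> real \<Rightarrow> real pmf" where
  "khinchin_normalized f t =
     map_pmf (\<lambda>n. (real n - khinchin_mean f t) / khinchin_sd f t) (khinchin f t)"

text \<open>The filter of real $t \uparrow R$ for an extended real $R \in (0, \infty]$.\<close>
definition at_left_ereal :: "ereal \<Rightarrow> real filter" where
  "at_left_ereal R = (if R = \<infinity> then at_top else at_left (real_of_ereal R))"

text \<open>
  Both suprema are over nonempty sets of reals that are bounded above: characteristic functions
  have modulus at most $1$, and the ranges of $\theta$ contain $0$ and $\pi\sigma(t)$ respectively.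
\<close>
definition hayman_class :: "real fps \<Rightarrow> bool" where
  "hayman_class f \<longleftrightarrow> khinchin_series f \<and>
     (\<exists>h :: real \<Rightarrow> real.
        (\<forall>t. 0 \<le> t \<and> ereal t < fps_conv_radius f \<longrightarrow> 0 < h t \<and> h t \<le> pi) \<and>
        ((\<lambda>t. SUP \<theta> \<in> {\<theta>. \<bar>\<theta>\<bar> \<le> h t * khinchin_sd f t}.
              cmod (char (khinchin_normalized f t) \<theta> * complex_of_real (exp (\<theta>\<^sup>2 / 2)) - 1))
           \<longlongrightarrow> 0) (at_left_ereal (fps_conv_radius f)) \<and>
        ((\<lambda>t. khinchin_sd f t *
              (SUP \<theta> \<in> {\<theta>. h t * khinchin_sd f t \<le> \<bar>\<theta>\<bar> \<and> \<bar>\<theta>\<bar> \<le> pi * khinchin_sd f t}.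
                 cmod (char (khinchin_normalized f t) \<theta>)))
           \<longlongrightarrow> 0) (at_left_ereal (fps_conv_radius f)) \<and>
        filterlim (khinchin_sd f) at_top (at_left_ereal (fps_conv_radius f)))"

definition complex_fps :: "real fps \<Rightarrow> complex fps" where
  "complex_fps F = Abs_fps (\<lambda>n. complex_of_real (fps_nth F n))"

lemma complex_fps_nth [simp]: "fps_nth (complex_fps F) n = complex_of_real (fps_nth F n)"
  by (simp add: complex_fps_def)

lemma complex_fps_mult: "complex_fps (F * G) = complex_fps F * complex_fps G"
  by (simp add: fps_eq_iff fps_mult_nth)

lemma complex_fps_power: "complex_fps (F ^ n) = complex_fps F ^ n"
  by (induction n) (simp_all add: complex_fps_mult, simp add: fps_eq_iff)

lemma complex_fps_compose: "complex_fps (F oo G) = complex_fps F oo complex_fps G"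
  by (simp add: fps_eq_iff fps_compose_nth flip: complex_fps_power)

lemma fps_conv_radius_complex_fps [simp]: "fps_conv_radius (complex_fps F) = fps_conv_radius F"
  by (simp add: fps_conv_radius_def conv_radius_def)

lemma eval_complex_fps_of_real:
  assumes "ereal \<bar>x\<bar> < fps_conv_radius F"
  shows "eval_fps (complex_fps F) (of_real x) = of_real (eval_fps F x)"
proof -
  have "(\<lambda>n. fps_nth F n * x ^ n) sums eval_fps F x"
    using assms by (intro sums_eval_fps) simp
  hence "(\<lambda>n. complex_of_real (fps_nth F n * x ^ n)) sums of_real (eval_fps F x)"
    by (rule sums_of_real)
  thus ?thesis by (simp add: eval_fps_def sums_iff)
qed

lemma eventually_in_conv_radius:
  assumes "0 < fps_conv_radius (F :: real fps)"
  shows "\<forall>\<^sub>F x::real in nhds 0. ereal \<bar>x\<bar> < fps_conv_radius F"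
proof -
  have "\<forall>\<^sub>F x in nhds 0. x \<in> eball 0 (fps_conv_radius F)"
    using assms by (intro eventually_nhds_in_open) (auto simp: zero_ereal_def)
  thus ?thesis by eventually_elim (simp add: in_eball_iff)
qed

text \<open>
  \<open>(\<lambda>x. exp (eval_fps g x)) has_fps_expansion f\<close> expresses that $f = e^g$ as power series. It
  determines \<open>f\<close> uniquely, and such an \<open>f\<close> exists whenever \<open>g\<close> converges near $0$; the constant
  term is split off because \<open>fps_compose\<close> requires it to vanish.
\<close>
lemma exp_fps_expansion_exists:
  fixes g :: "real fps"
  assumes g: "0 < fps_conv_radius g"
  shows "(\<lambda>x. exp (eval_fps g x)) has_fps_expansion
           fps_const (exp (fps_nth g 0)) * (fps_exp 1 oo (g - fps_const (fps_nth g 0)))"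
    (is "_ has_fps_expansion ?F")
proof -
  define c where "c = fps_nth g 0"
  have E: "complex_fps (fps_exp 1) = fps_exp 1"
    and D: "complex_fps (g - fps_const c) = complex_fps g - fps_const (of_real c)"
    and C: "complex_fps (fps_const (exp c)) = fps_const (exp (of_real c))"
    by (simp_all add: fps_eq_iff exp_of_real)
  have "(\<lambda>z. eval_fps (complex_fps g) z - of_real c) has_fps_expansion
      complex_fps g - fps_const (of_real c)"
    by (intro has_fps_expansion_diff has_fps_expansion_const)
       (use g in \<open>simp add: has_fps_expansion_def\<close>)
  hence "(exp \<circ> (\<lambda>z. eval_fps (complex_fps g) z - of_real c)) has_fps_expansion
      (fps_exp 1 oo (complex_fps g - fps_const (of_real c)))"
    by (intro has_fps_expansion_compose has_fps_expansion_exp1) (simp_all add: c_def)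
  hence "(\<lambda>z. exp (of_real c) * (exp \<circ> (\<lambda>z. eval_fps (complex_fps g) z - of_real c)) z)
      has_fps_expansion
      fps_const (exp (of_real c)) * (fps_exp 1 oo (complex_fps g - fps_const (of_real c)))"
    by (intro has_fps_expansion_cmult_left)
  hence "(\<lambda>z. exp (eval_fps (complex_fps g) z)) has_fps_expansion complex_fps ?F"
    unfolding complex_fps_mult complex_fps_compose c_def [symmetric] D E C
    by (simp flip: exp_add)
  hence F: "0 < fps_conv_radius ?F"
    and ev: "\<forall>\<^sub>F z in nhds 0. eval_fps (complex_fps ?F) z = exp (eval_fps (complex_fps g) z)"
    by (simp_all add: has_fps_expansion_def)
  have "filterlim complex_of_real (nhds 0) (nhds 0)"
    using tendsto_of_real[OF filterlim_ident[of "nhds (0::real)"]] by simp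
  from eventually_compose_filterlim[OF ev this]
    eventually_in_conv_radius[OF F] eventually_in_conv_radius[OF g]
  have "\<forall>\<^sub>F x in nhds 0. eval_fps ?F x = exp (eval_fps g x)"
  proof eventually_elim
    case (elim x)
    hence "complex_of_real (eval_fps ?F x) = of_real (exp (eval_fps g x))"
      by (simp only: eval_complex_fps_of_real exp_of_real)
    thus ?case by (simp only: of_real_eq_iff)
  qed
  with F show ?thesis by (simp add: has_fps_expansion_def)
qed

end

theory Submission
  imports Defs "HOL-Real_Asymp.Real_Asymp"
begin

text \<open>
  The characteristic function of $X_t$ is $\exp (g(te^{i\varphi}) - g(t))$, so with
  $D = z\,d/dz$ the cumulants of $X_t$ are $Dg(t), D^2g(t), D^3g(t), \dots$; in particular
  $\sigma^2 = D^2g$. Take $h(t) = e^{-\gamma t}$.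

  For $|\varphi| \le h(t)$, Taylor expansion of each $e^{in\varphi}$ bounds the error in the exponent
  by $h^3 D^3g / 6$, and $D^3g(t) = O(e^{lt})$ for every $l > \lambda$: this tends to $0$ when
  $3\gamma > l$. For $h(t) \le |\varphi| \le \pi$, the lower bound on the coefficients gives
  $g(t) - \mathrm{Re}\,g(te^{i\varphi}) \ge B (e^{\beta t} - e^{\beta t \cos h(t)})$, which is of
  order $t e^{(\beta - 2\gamma)t}$ and beats $\log \sigma = O(t)$ when $2\gamma < \beta$. Such a
  $\gamma$ exists because $2\lambda < 3\beta$.
\<close>

section \<open>The identity \<open>f = e^g\<close> at complex arguments\<close>

text \<open>The hypothesis only speaks of real points near 0, while characteristic functions require
  complex ones. Both sides are holomorphic on a disc and agree on a real segment accumulating at 0,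
  so the identity theorem applies.\<close>

lemma complex_exp_fps_expansion:
  fixes f g :: "real fps"
  assumes g: "0 < fps_conv_radius g"
    and f: "(\<lambda>x. exp (eval_fps g x)) has_fps_expansion f"
  shows "(\<lambda>z. exp (eval_fps (complex_fps g) z)) has_fps_expansion complex_fps f"
proof -
  have f0: "0 < fps_conv_radius f"
    and ev: "\<forall>\<^sub>F x in nhds 0. eval_fps f x = exp (eval_fps g x)"
    using f by (auto simp: has_fps_expansion_def)
  from ev eventually_in_conv_radius[OF f0] eventually_in_conv_radius[OF g]
  have "\<forall>\<^sub>F x in nhds 0. ereal \<bar>x\<bar> < fps_conv_radius f \<and> ereal \<bar>x\<bar> < fps_conv_radius g \<and>
      eval_fps f x = exp (eval_fps g x)"
    by eventually_elim auto
  then obtain e where e: "e > 0" and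
    e': "\<And>x. \<bar>x\<bar> < e \<Longrightarrow> ereal \<bar>x\<bar> < fps_conv_radius f \<and> ereal \<bar>x\<bar> < fps_conv_radius g \<and>
      eval_fps f x = exp (eval_fps g x)"
    unfolding eventually_nhds_metric by (auto simp: dist_norm)
  let ?S = "ball (0::complex) e"
  \<comment> \<open>Applying \<open>e'\<close> to the real number \<open>norm z\<close> puts the
    whole complex disc inside both discs of convergence.\<close>
  have rad: "ereal (norm z) < fps_conv_radius f \<and> ereal (norm z) < fps_conv_radius g"
    if "z \<in> ?S" for z
    using e'[of "norm z"] that by simp
  have "eval_fps (complex_fps f) z - exp (eval_fps (complex_fps g) z) = 0" if z: "z \<in> ?S" for z
  proof (rule analytic_continuation[where S = ?S and \<xi> = 0 and U = "of_real ` {0<..<e}"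
        and f = "\<lambda>z. eval_fps (complex_fps f) z - exp (eval_fps (complex_fps g) z)"])
    show "(\<lambda>z. eval_fps (complex_fps f) z - exp (eval_fps (complex_fps g) z)) holomorphic_on ?S"
      by (intro holomorphic_intros) (use rad in \<open>auto simp: in_eball_iff\<close>)
    show "(0::complex) islimpt of_real ` {0<..<e}"
    proof (subst islimpt_approachable, intro allI impI)
      fix d :: real assume "0 < d"
      then show "\<exists>x'\<in>complex_of_real ` {0<..<e}. x' \<noteq> 0 \<and> dist x' 0 < d"
        using e by (intro bexI[OF _ imageI[of "min d e / 2"]]) auto
    qed
    show "eval_fps (complex_fps f) z - exp (eval_fps (complex_fps g) z) = 0"
      if z: "z \<in> of_real ` {0<..<e}" for z
    proof -
      from z obtain x where x: "z = of_real x" "0 < x" "x < e" by auto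
      show ?thesis using e'[of x] x by (simp add: eval_complex_fps_of_real exp_of_real)
    qed
  qed (use e z in auto)
  moreover have "\<forall>\<^sub>F z in nhds 0. z \<in> ?S"
    using e by (intro eventually_nhds_in_open) auto
  ultimately have "\<forall>\<^sub>F z in nhds 0. eval_fps (complex_fps f) z = exp (eval_fps (complex_fps g) z)"
    by (auto elim: eventually_mono)
  with f0 show ?thesis by (simp add: has_fps_expansion_def)
qed

text \<open>Complex expansions are unique and \<open>complex_fps\<close> is injective. The closed
  form makes the coefficients and the derivative of \<open>f\<close> accessible.\<close>

lemma exp_fps_expansion_unique:
  fixes f g :: "real fps"
  assumes g: "0 < fps_conv_radius g"
    and f: "(\<lambda>x. exp (eval_fps g x)) has_fps_expansion f"
  shows "f = fps_const (exp (fps_nth g 0)) * (fps_exp 1 oo (g - fps_const (fps_nth g 0)))"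
proof -
  have "complex_fps f =
      complex_fps (fps_const (exp (fps_nth g 0)) * (fps_exp 1 oo (g - fps_const (fps_nth g 0))))"
    using complex_exp_fps_expansion[OF g f]
      complex_exp_fps_expansion[OF g exp_fps_expansion_exists[OF g]]
    by (rule fps_expansion_unique_complex)
  then show ?thesis unfolding fps_eq_iff complex_fps_nth of_real_eq_iff .
qed

section \<open>Expectations as series and elementary inequalities\<close>

text \<open>The law has density \<open>pmf p\<close> with respect to counting measure. Values in a
  Banach space cover both the real moments and the complex characteristic function.\<close>

lemma pmf_expectation_suminf:
  fixes h :: "nat \<Rightarrow> 'a :: {banach, second_countable_topology}"
  assumes "summable (\<lambda>n. norm (pmf p n *\<^sub>R h n))"
  shows "integrable (measure_pmf p) h"
    and "measure_pmf.expectation p h = (\<Sum>n. pmf p n *\<^sub>R h n)"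
proof -
  have I: "integrable (count_space UNIV) (\<lambda>n. pmf p n *\<^sub>R h n)"
    using assms by (simp add: integrable_count_space_nat_iff)
  show "integrable (measure_pmf p) h"
    unfolding measure_pmf_eq_density using I by (subst integrable_density) auto
  show "measure_pmf.expectation p h = (\<Sum>n. pmf p n *\<^sub>R h n)"
    unfolding measure_pmf_eq_density using integral_count_space_nat[OF I]
    by (subst integral_density) auto
qed

text \<open>Termwise comparison of the exponential series without its constant term.\<close>

lemma norm_exp_minus_one_le:
  fixes z :: "'a :: {banach, real_normed_field}"
  shows "norm (exp z - 1) \<le> exp (norm z) - 1"
proof -
  have "(\<lambda>n. z ^ Suc n /\<^sub>R fact (Suc n)) sums (exp z - 1)"
    using sums_split_initial_segment[OF exp_converges[of z], of 1] by simp
  moreover have "(\<lambda>n. norm z ^ Suc n /\<^sub>R fact (Suc n)) sums (exp (norm z) - 1)"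
    using sums_split_initial_segment[OF exp_converges[of "norm z"], of 1] by simp
  moreover have "norm (z ^ Suc n /\<^sub>R fact (Suc n)) \<le> norm z ^ Suc n /\<^sub>R fact (Suc n)" for n
    by (simp add: norm_power norm_mult)
  ultimately show ?thesis
    by (rule norm_sums_le)
qed

lemma fps_conv_radius_XD_infinity:
  fixes F :: "'a :: {banach, real_normed_field} fps"
  shows "fps_conv_radius F = \<infinity> \<Longrightarrow> fps_conv_radius (fps_XD F) = \<infinity>"
  using fps_conv_radius_deriv[of F] fps_conv_radius_mult[of fps_X "fps_deriv F"]
  by (simp add: fps_XD_def)

lemma fps_power_nth_nonneg:
  fixes F :: "'a :: linordered_idom fps"
  assumes "\<And>n. 0 \<le> fps_nth F n"
  shows "0 \<le> fps_nth (F ^ k) n"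
  by (induction k arbitrary: n) (auto simp: fps_mult_nth intro!: sum_nonneg mult_nonneg_nonneg assms)

text \<open>The real part of \<open>(t e^(i\<phi>))^n\<close> is \<open>t^n cos (n\<phi>)\<close>.
  For \<open>t \<ge> 0\<close> the weights \<open>t^n (1 - cos (n\<phi>))\<close> are nonnegative
  and vanish at \<open>n = 0\<close>, so coefficient bounds for \<open>n \<ge> 1\<close> transfer to
  the whole difference.\<close>

lemma sums_eval_fps_minus_Re_eval_fps:
  fixes F :: "real fps"
  assumes "fps_conv_radius F = \<infinity>"
  shows "(\<lambda>n. fps_nth F n * t ^ n * (1 - cos (real n * \<phi>))) sums
    (eval_fps F t - Re (eval_fps (complex_fps F) (of_real t * iexp \<phi>)))"
proof -
  have "(\<lambda>n. fps_nth F n * t ^ n - Re (fps_nth (complex_fps F) n * (of_real t * iexp \<phi>) ^ n)) sums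
    (eval_fps F t - Re (eval_fps (complex_fps F) (of_real t * iexp \<phi>)))"
    by (intro sums_diff sums_Re sums_eval_fps) (simp_all add: assms)
  moreover have "Re (fps_nth (complex_fps F) n * (of_real t * iexp \<phi>) ^ n) =
      fps_nth F n * t ^ n * cos (real n * \<phi>)" for n
  proof -
    have "(of_real t * iexp \<phi>) ^ n = of_real (t ^ n) * iexp (real n * \<phi>)"
      by (simp add: power_mult_distrib flip: exp_of_nat_mult) (simp add: algebra_simps)
    then show ?thesis by (simp add: Re_exp)
  qed
  ultimately show ?thesis by (simp only: right_diff_distrib mult_1_right)
qed

text \<open>The modulus of \<open>exp (x e^(i\<phi>))\<close> is \<open>exp (x cos \<phi>)\<close>,
  and cosine is even and decreasing on \<open>[0, pi]\<close>.\<close>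

lemma exp_minus_Re_exp_ge:
  assumes "0 \<le> x" "0 \<le> h" "h \<le> \<bar>\<phi>\<bar>" "\<bar>\<phi>\<bar> \<le> pi"
  shows "exp x - exp (x * cos h) \<le> exp x - Re (exp (of_real x * iexp \<phi>))"
proof -
  have "cos \<phi> \<le> cos h"
    using cos_monotone_0_pi_le[of h "\<bar>\<phi>\<bar>"] assms by simp
  then have "x * cos \<phi> \<le> x * cos h"
    using assms by (intro mult_left_mono)
  moreover have "Re (exp (of_real x * iexp \<phi>)) \<le> exp (x * cos \<phi>)"
    using complex_Re_le_cmod[of "exp (of_real x * iexp \<phi>)"] by (simp add: Re_exp)
  ultimately show ?thesis
    using exp_le_cancel_iff[of "x * cos \<phi>" "x * cos h"] by linarith
qed

lemma cSUP_nonneg_le: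
  fixes u :: "'a \<Rightarrow> real"
  assumes "A \<noteq> {}" "\<And>x. x \<in> A \<Longrightarrow> 0 \<le> u x" "\<And>x. x \<in> A \<Longrightarrow> u x \<le> c"
  shows "0 \<le> (SUP x\<in>A. u x)" "(SUP x\<in>A. u x) \<le> c"
proof -
  obtain a where "a \<in> A" using assms(1) by blast
  moreover have "bdd_above (u ` A)" using assms(3) by (intro bdd_aboveI2[of _ _ c])
  ultimately show "0 \<le> (SUP x\<in>A. u x)"
    using assms(2) by (meson cSUP_upper order_trans)
  show "(SUP x\<in>A. u x) \<le> c" using assms by (intro cSUP_least)
qed

section \<open>Entire exponents with nonnegative coefficients\<close>

text \<open>The positive coefficient at index 1 makes \<open>f\<close> nonconstant and forces the
  standard deviation to grow at least like \<open>sqrt t\<close>.\<close>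

locale entire_exp =
  fixes f g :: "real fps"
  assumes g_nonneg: "0 \<le> fps_nth g n"
    and g_radius: "fps_conv_radius g = \<infinity>"
    and g_1_pos: "0 < fps_nth g 1"
    and f_expansion: "(\<lambda>x. exp (eval_fps g x)) has_fps_expansion f"
begin

lemma f_eq: "f = fps_const (exp (fps_nth g 0)) * (fps_exp 1 oo (g - fps_const (fps_nth g 0)))"
  using exp_fps_expansion_unique[OF _ f_expansion] g_radius by simp

lemma complex_f_expansion: "(\<lambda>z. exp (eval_fps (complex_fps g) z)) has_fps_expansion complex_fps f"
  using complex_exp_fps_expansion[OF _ f_expansion] g_radius by simp

lemma holomorphic_exp_g: "(\<lambda>z. exp (eval_fps (complex_fps g) z)) holomorphic_on A"
  by (intro holomorphic_intros) (auto simp: g_radius in_eball_iff)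

text \<open>The function \<open>e^g\<close> is entire, so its expansion converges
  everywhere.\<close>

lemma f_radius: "fps_conv_radius f = \<infinity>"
  using holomorphic_on_imp_fps_conv_radius_ge[OF complex_f_expansion holomorphic_exp_g, of \<infinity>]
  by simp

lemma eval_complex_f: "eval_fps (complex_fps f) z = exp (eval_fps (complex_fps g) z)"
  by (rule has_fps_expansion_imp_eval_fps_eq[OF complex_f_expansion _ holomorphic_exp_g,
        of _ "norm z + 1"]) simp

lemma eval_f: "eval_fps f x = exp (eval_fps g x)"
proof -
  have "complex_of_real (eval_fps f x) = of_real (exp (eval_fps g x))"
    using eval_complex_f[of "of_real x"] f_radius g_radius
    by (simp add: eval_complex_fps_of_real exp_of_real)
  then show ?thesis by (simp only: of_real_eq_iff)
qed

text \<open>In the closed form, \<open>f\<close> is a positive constant times a sum of powers of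
  \<open>g - g(0)\<close> divided by factorials.\<close>

lemma f_nonneg: "0 \<le> fps_nth f n"
proof -
  have "0 \<le> fps_nth (g - fps_const (fps_nth g 0)) k" for k
    using g_nonneg[of k] by (cases k) simp_all
  then have "0 \<le> fps_nth ((g - fps_const (fps_nth g 0)) ^ k) n" for k
    by (rule fps_power_nth_nonneg)
  then show ?thesis
    by (subst f_eq) (simp add: fps_compose_nth sum_nonneg)
qed

lemma f_0_pos: "0 < fps_nth f 0"
  by (subst f_eq) simp

section \<open>Law, moments and characteristic function of \<open>khinchin f t\<close>\<close>

lemma XD_f: "fps_XD f = fps_XD g * f"
proof -
  have "fps_deriv f = fps_deriv g * f"
    by (subst (1 2) f_eq) (simp add: fps_compose_deriv algebra_simps)
  then show ?thesis by (simp add: fps_XD_def algebra_simps)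
qed

text \<open>Dividing by \<open>f\<close> shows that the second moment is
  \<open>D^2 g + (D g)^2\<close>; since the mean is \<open>D g\<close>, the variance is
  \<open>D^2 g\<close>.\<close>

lemma XD_XD_f: "fps_XD (fps_XD f) = (fps_XD (fps_XD g) + (fps_XD g)\<^sup>2) * f"
proof -
  have "fps_XD (fps_XD f) = fps_XD (fps_XD g) * f + fps_XD g * fps_XD f"
    by (subst XD_f) (simp add: fps_XD_def algebra_simps)
  then show ?thesis by (simp add: XD_f algebra_simps power2_eq_square)
qed

lemma khinchin_series_f: "khinchin_series f"
proof -
  have "fps_nth (fps_XD f) 1 = fps_nth g 1 * fps_nth f 0"
    unfolding XD_f by (simp add: fps_mult_nth fps_XD_nth)
  then have "fps_nth f 1 \<noteq> 0"
    using g_1_pos f_0_pos by (auto simp: fps_XD_nth)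
  then show ?thesis
    using f_nonneg f_0_pos f_radius unfolding khinchin_series_def by (auto intro: exI[of _ 1])
qed

text \<open>The constructor \<open>embed_pmf\<close> yields the intended weights once they are known
  to be nonnegative with sum 1; the normalizer \<open>eval_fps f t\<close> is an exponential, hence
  positive.\<close>

lemma pmf_khinchin:
  assumes "0 \<le> t"
  shows "pmf (khinchin f t) n = fps_nth f n * t ^ n / eval_fps f t"
  unfolding khinchin_def
proof (rule pmf_embed_pmf)
  show nn: "0 \<le> fps_nth f n * t ^ n / eval_fps f t" for n
    using assms f_nonneg by (simp add: eval_f)
  have "(\<lambda>n. fps_nth f n * t ^ n / eval_fps f t) sums (eval_fps f t / eval_fps f t)"
    by (intro sums_divide sums_eval_fps) (simp add: f_radius)
  then have "(\<lambda>n. fps_nth f n * t ^ n / eval_fps f t) sums 1"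
    by (simp add: eval_f)
  then show "(\<integral>\<^sup>+ n. ennreal (fps_nth f n * t ^ n / eval_fps f t) \<partial>count_space UNIV) = 1"
    using suminf_ennreal_eq[OF nn] by (simp add: nn_integral_count_space_nat)
qed

text \<open>Weighting the coefficients of \<open>f\<close> by \<open>w\<close> gives a series
  \<open>F\<close>; the choices \<open>D f\<close> and \<open>D^2 f\<close> yield the first two
  moments.\<close>

lemma expectation_khinchin:
  fixes w :: "nat \<Rightarrow> real"
  assumes t: "0 \<le> t" and F: "\<And>n. fps_nth F n = w n * fps_nth f n" "fps_conv_radius F = \<infinity>"
  shows "integrable (measure_pmf (khinchin f t)) w"
    and "measure_pmf.expectation (khinchin f t) w = eval_fps F t / eval_fps f t"
proof -
  have eq: "pmf (khinchin f t) n *\<^sub>R w n = fps_nth F n * t ^ n / eval_fps f t" for n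
    by (simp add: pmf_khinchin t F)
  have "summable (\<lambda>n. norm (fps_nth F n * t ^ n) / \<bar>eval_fps f t\<bar>)"
    by (intro summable_divide norm_summable_fps) (simp add: F)
  then have S: "summable (\<lambda>n. norm (pmf (khinchin f t) n *\<^sub>R w n))"
    unfolding eq by simp
  then show "integrable (measure_pmf (khinchin f t)) w"
    by (rule pmf_expectation_suminf)
  have "(\<lambda>n. fps_nth F n * t ^ n / eval_fps f t) sums (eval_fps F t / eval_fps f t)"
    by (intro sums_divide sums_eval_fps) (simp add: F)
  then show "measure_pmf.expectation (khinchin f t) w = eval_fps F t / eval_fps f t"
    using pmf_expectation_suminf(2)[OF S] unfolding eq by (simp add: sums_iff)
qed

lemma khinchin_mean_eq:
  assumes "0 \<le> t"
  shows "khinchin_mean f t = eval_fps (fps_XD g) t"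
proof -
  have "khinchin_mean f t = eval_fps (fps_XD f) t / eval_fps f t"
    unfolding khinchin_mean_def using assms f_radius
    by (intro expectation_khinchin) (auto simp: fps_XD_nth fps_conv_radius_XD_infinity)
  then show ?thesis
    by (simp add: XD_f eval_fps_mult fps_conv_radius_XD_infinity g_radius f_radius eval_f)
qed

lemma khinchin_sd_eq:
  assumes t: "0 \<le> t"
  shows "khinchin_sd f t = sqrt (eval_fps (fps_XD (fps_XD g)) t)"
proof -
  note [simp] = fps_conv_radius_XD_infinity g_radius f_radius
  note sq = expectation_khinchin[OF t, of "fps_XD (fps_XD f)" "\<lambda>n. (real n)\<^sup>2"]
  have R: "fps_conv_radius (fps_XD (fps_XD g) + (fps_XD g)\<^sup>2) = \<infinity>"
    using fps_conv_radius_add[of "fps_XD (fps_XD g)" "(fps_XD g)\<^sup>2"]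
      fps_conv_radius_power[of "fps_XD g" 2] by simp
  have R2: "fps_conv_radius ((fps_XD g)\<^sup>2) = \<infinity>"
    using fps_conv_radius_power[of "fps_XD g" 2] by simp
  have "measure_pmf.expectation (khinchin f t) (\<lambda>n. (real n)\<^sup>2) =
      eval_fps (fps_XD (fps_XD f)) t / eval_fps f t"
    by (rule sq(2)) (simp_all add: fps_XD_nth power2_eq_square)
  also have "\<dots> = eval_fps (fps_XD (fps_XD g)) t + (eval_fps (fps_XD g) t)\<^sup>2"
    unfolding XD_XD_f by (simp add: eval_fps_mult eval_fps_add eval_fps_power R R2 eval_f)
  finally have "measure_pmf.variance (khinchin f t) real = eval_fps (fps_XD (fps_XD g)) t"
    using khinchin_mean_eq[OF t] expectation_khinchin(1)[OF t, of "fps_XD f" real] sq(1)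
    unfolding khinchin_mean_def
    by (subst measure_pmf.variance_eq) (auto simp: fps_XD_nth power2_eq_square)
  then show ?thesis by (simp add: khinchin_sd_def)
qed

text \<open>The expectation of \<open>e^(i\<phi>X)\<close> is
  \<open>f(t e^(i\<phi>)) / f(t)\<close>, and centring contributes the factor \<open>?c\<close>. If
  the standard deviation is 0, division by zero gives \<open>\<phi> = 0\<close> and both sides equal
  1.\<close>

lemma char_khinchin_normalized:
  fixes \<theta> t :: real
  assumes t: "0 \<le> t"
  defines "\<phi> \<equiv> \<theta> / khinchin_sd f t"
  shows "char (khinchin_normalized f t) \<theta> =
    exp (eval_fps (complex_fps g) (of_real t * iexp \<phi>) - of_real (eval_fps g t)
      - \<i> * of_real (\<phi> * khinchin_mean f t))"
proof -
  let ?c = "iexp (- (\<phi> * khinchin_mean f t))"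
  have eq: "pmf (khinchin f t) n *\<^sub>R iexp (\<theta> * ((real n - khinchin_mean f t) / khinchin_sd f t)) =
      ?c * (fps_nth (complex_fps f) n * (of_real t * iexp \<phi>) ^ n) / of_real (eval_fps f t)" for n
  proof -
    have "iexp (\<theta> * ((real n - khinchin_mean f t) / khinchin_sd f t)) = ?c * iexp \<phi> ^ n"
      unfolding exp_of_nat_mult[symmetric] exp_add[symmetric] \<phi>_def
      by (simp add: diff_divide_distrib algebra_simps)
    then show ?thesis
      by (simp add: pmf_khinchin t scaleR_conv_of_real power_mult_distrib)
  qed
  \<comment> \<open>The exponentials have modulus 1, so absolute summability is that of the
    weights.\<close>
  have "(\<lambda>n. norm (pmf (khinchin f t) n *\<^sub>R
      iexp (\<theta> * ((real n - khinchin_mean f t) / khinchin_sd f t)))) = pmf (khinchin f t)"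
    by (simp add: fun_eq_iff)
  moreover have "summable (pmf (khinchin f t))"
    unfolding pmf_khinchin[OF t]
    by (intro summable_divide summable_fps) (simp add: f_radius)
  ultimately have S: "summable (\<lambda>n. norm (pmf (khinchin f t) n *\<^sub>R
      iexp (\<theta> * ((real n - khinchin_mean f t) / khinchin_sd f t))))"
    by simp
  have "char (khinchin_normalized f t) \<theta> = measure_pmf.expectation (khinchin f t)
      (\<lambda>n. iexp (\<theta> * ((real n - khinchin_mean f t) / khinchin_sd f t)))"
    by (simp add: char_def khinchin_normalized_def)
  also have "\<dots> = (\<Sum>n. ?c * (fps_nth (complex_fps f) n * (of_real t * iexp \<phi>) ^ n) /
      of_real (eval_fps f t))"
    using pmf_expectation_suminf(2)[OF S] unfolding eq .
  also have "\<dots> = ?c * eval_fps (complex_fps f) (of_real t * iexp \<phi>) / of_real (eval_fps f t)"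
    by (intro sums_unique[symmetric] sums_divide sums_mult sums_eval_fps) (simp add: f_radius)
  finally show ?thesis
    by (simp add: eval_complex_f eval_f exp_diff exp_minus exp_add field_simps flip: exp_of_real)
qed


section \<open>Cumulant bounds and the Gaussian approximation\<close>

text \<open>Third derivative at \<open>s = 0\<close> of
  \<open>log E(e^(s X_t)) = g(t e^s) - g(t)\<close>.\<close>

abbreviation third_cumulant :: "real \<Rightarrow> real" where
  "third_cumulant t \<equiv> eval_fps (fps_XD (fps_XD (fps_XD g))) t"

lemma eval_XD_XD_nonneg:
  assumes "0 \<le> t"
  shows "0 \<le> eval_fps (fps_XD (fps_XD g)) t"
proof (rule sums_le[OF _ sums_zero])
  show "(\<lambda>n. fps_nth (fps_XD (fps_XD g)) n * t ^ n) sums eval_fps (fps_XD (fps_XD g)) t"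
    by (intro sums_eval_fps) (simp add: fps_conv_radius_XD_infinity g_radius)
  show "0 \<le> fps_nth (fps_XD (fps_XD g)) n * t ^ n" for n
    using assms g_nonneg by simp
qed

text \<open>Since \<open>n^2 \<le> n^3\<close> for natural \<open>n\<close>, one bound on the third
  cumulant also controls the variance.\<close>

lemma eval_XD_XD_le_third_cumulant:
  assumes "0 \<le> t"
  shows "eval_fps (fps_XD (fps_XD g)) t \<le> third_cumulant t"
proof (rule sums_le)
  show "(\<lambda>n. fps_nth (fps_XD (fps_XD g)) n * t ^ n) sums eval_fps (fps_XD (fps_XD g)) t"
    "(\<lambda>n. fps_nth (fps_XD (fps_XD (fps_XD g))) n * t ^ n) sums third_cumulant t"
    by (intro sums_eval_fps; simp add: fps_conv_radius_XD_infinity g_radius)+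
  show "fps_nth (fps_XD (fps_XD g)) n * t ^ n \<le> fps_nth (fps_XD (fps_XD (fps_XD g))) n * t ^ n" for n
  proof (cases n)
    case (Suc m)
    have "1 * fps_nth (fps_XD (fps_XD g)) n \<le> real n * fps_nth (fps_XD (fps_XD g)) n"
      using g_nonneg[of n] Suc by (intro mult_right_mono) auto
    then show ?thesis using assms by (intro mult_right_mono) auto
  qed simp
qed

lemma third_cumulant_nonneg: "0 \<le> t \<Longrightarrow> 0 \<le> third_cumulant t"
  using eval_XD_XD_nonneg eval_XD_XD_le_third_cumulant by (meson order_trans)

text \<open>Only the term \<open>n = 1\<close> of the variance series is kept. This yields both
  positivity and divergence of the standard deviation.\<close>

lemma sqrt_le_khinchin_sd:
  assumes "0 \<le> t"
  shows "sqrt (fps_nth g 1 * t) \<le> khinchin_sd f t"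
proof -
  have "fps_nth g 1 * t \<le> eval_fps (fps_XD (fps_XD g)) t"
  proof (rule sums_le)
    show "(\<lambda>n. if n = 1 then fps_nth g n * t ^ n else 0) sums (fps_nth g 1 * t)"
      using sums_single[of 1 "\<lambda>n. fps_nth g n * t ^ n"] by simp
    show "(\<lambda>n. fps_nth (fps_XD (fps_XD g)) n * t ^ n) sums eval_fps (fps_XD (fps_XD g)) t"
      by (intro sums_eval_fps) (simp add: fps_conv_radius_XD_infinity g_radius)
  qed (use assms g_nonneg in auto)
  then show ?thesis by (simp add: khinchin_sd_eq assms)
qed

lemma khinchin_sd_squared:
  "0 \<le> t \<Longrightarrow> (khinchin_sd f t)\<^sup>2 = eval_fps (fps_XD (fps_XD g)) t"
  using eval_XD_XD_nonneg by (simp add: khinchin_sd_eq)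

text \<open>Each summand is \<open>g_n t^n\<close> times the remainder of the quadratic Taylor
  polynomial of \<open>e^(in\<phi>)\<close>, which is at most \<open>|n\<phi>|^3 / 6\<close>; the
  factors \<open>n^3\<close> add up to \<open>D^3 g\<close>.\<close>

lemma log_char_approx:
  assumes t: "0 \<le> t"
  shows "norm (eval_fps (complex_fps g) (of_real t * iexp \<phi>) - of_real (eval_fps g t)
      - \<i> * of_real (\<phi> * eval_fps (fps_XD g) t)
      + of_real (\<phi>\<^sup>2 / 2 * eval_fps (fps_XD (fps_XD g)) t)) \<le> \<bar>\<phi>\<bar> ^ 3 / 6 * third_cumulant t"
proof (rule norm_sums_le)
  note [simp] = fps_conv_radius_XD_infinity g_radius
  show "(\<lambda>n. fps_nth (complex_fps g) n * (of_real t * iexp \<phi>) ^ n - of_real (fps_nth g n * t ^ n)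
      - \<i> * of_real (\<phi> * (fps_nth (fps_XD g) n * t ^ n))
      + of_real (\<phi>\<^sup>2 / 2 * (fps_nth (fps_XD (fps_XD g)) n * t ^ n))) sums
     (eval_fps (complex_fps g) (of_real t * iexp \<phi>) - of_real (eval_fps g t)
      - \<i> * of_real (\<phi> * eval_fps (fps_XD g) t)
      + of_real (\<phi>\<^sup>2 / 2 * eval_fps (fps_XD (fps_XD g)) t))"
    by (intro sums_add sums_diff sums_mult sums_of_real sums_eval_fps) simp_all
  show "(\<lambda>n. \<bar>\<phi>\<bar> ^ 3 / 6 * (fps_nth (fps_XD (fps_XD (fps_XD g))) n * t ^ n)) sums
      (\<bar>\<phi>\<bar> ^ 3 / 6 * third_cumulant t)"
    by (intro sums_mult sums_eval_fps) simp
  fix n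
  let ?x = "real n * \<phi>"
  have p: "(of_real t * iexp \<phi>) ^ n = of_real (t ^ n) * iexp ?x"
    by (simp add: power_mult_distrib flip: exp_of_nat_mult) (simp add: algebra_simps)
  \<comment> \<open>The subtracted terms of order 0, 1 and 2 in \<open>\<phi>\<close> are exactly
    the Taylor polynomial at \<open>n\<phi>\<close>.\<close>
  have "fps_nth (complex_fps g) n * (of_real t * iexp \<phi>) ^ n - of_real (fps_nth g n * t ^ n)
      - \<i> * of_real (\<phi> * (fps_nth (fps_XD g) n * t ^ n))
      + of_real (\<phi>\<^sup>2 / 2 * (fps_nth (fps_XD (fps_XD g)) n * t ^ n)) =
     of_real (fps_nth g n * t ^ n) * (iexp ?x - (\<Sum>k\<le>2. (\<i> * of_real ?x) ^ k / fact k))"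
    unfolding p by (simp add: numeral_2_eq_2 algebra_simps)
  also have "norm \<dots> = fps_nth g n * t ^ n * norm (iexp ?x - (\<Sum>k\<le>2. (\<i> * of_real ?x) ^ k / fact k))"
    unfolding norm_mult[of "of_real _"] norm_of_real using g_nonneg[of n] t by simp
  also have "\<dots> \<le> fps_nth g n * t ^ n * (\<bar>?x\<bar> ^ Suc 2 / fact (Suc 2))"
    using g_nonneg[of n] t by (intro mult_left_mono iexp_approx1) simp
  also have "\<dots> = \<bar>\<phi>\<bar> ^ 3 / 6 * (fps_nth (fps_XD (fps_XD (fps_XD g))) n * t ^ n)"
    by (simp add: abs_mult fact_numeral numeral_3_eq_3)
  finally show "norm (fps_nth (complex_fps g) n * (of_real t * iexp \<phi>) ^ n
      - of_real (fps_nth g n * t ^ n) - \<i> * of_real (\<phi> * (fps_nth (fps_XD g) n * t ^ n))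
      + of_real (\<phi>\<^sup>2 / 2 * (fps_nth (fps_XD (fps_XD g)) n * t ^ n))) \<le>
      \<bar>\<phi>\<bar> ^ 3 / 6 * (fps_nth (fps_XD (fps_XD (fps_XD g))) n * t ^ n)" .
qed

text \<open>With \<open>\<theta> = \<phi>\<sigma>\<close> and \<open>\<sigma>^2 = D^2 g\<close>, the
  factor \<open>exp (\<theta>^2 / 2)\<close> cancels the quadratic term of the exponent. What
  remains is \<open>e^z - 1\<close> with \<open>z\<close> of third order.\<close>

lemma char_normalized_approx:
  assumes t: "0 \<le> t" and sd: "0 < khinchin_sd f t" and \<theta>: "\<bar>\<theta>\<bar> \<le> h * khinchin_sd f t"
  shows "cmod (char (khinchin_normalized f t) \<theta> * complex_of_real (exp (\<theta>\<^sup>2 / 2)) - 1) \<le>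
    exp (h ^ 3 / 6 * third_cumulant t) - 1"
proof -
  define \<phi> where "\<phi> = \<theta> / khinchin_sd f t"
  have \<phi>: "\<bar>\<phi>\<bar> \<le> h"
    using \<theta> sd by (simp add: \<phi>_def field_simps)
  have "\<theta>\<^sup>2 / 2 = \<phi>\<^sup>2 / 2 * eval_fps (fps_XD (fps_XD g)) t"
    using sd by (simp add: \<phi>_def power_divide flip: khinchin_sd_squared[OF t])
  then have "char (khinchin_normalized f t) \<theta> * complex_of_real (exp (\<theta>\<^sup>2 / 2)) =
      exp (eval_fps (complex_fps g) (of_real t * iexp \<phi>) - of_real (eval_fps g t)
      - \<i> * of_real (\<phi> * eval_fps (fps_XD g) t)
      + of_real (\<phi>\<^sup>2 / 2 * eval_fps (fps_XD (fps_XD g)) t))"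
    unfolding exp_add char_khinchin_normalized[OF t] khinchin_mean_eq[OF t] \<phi>_def
    by (simp only: exp_of_real)
  also have "cmod (\<dots> - 1) \<le> exp (\<bar>\<phi>\<bar> ^ 3 / 6 * third_cumulant t) - 1"
    using norm_exp_minus_one_le log_char_approx[OF t, of \<phi>]
    by (meson diff_right_mono exp_le_cancel_iff order_trans)
  also have "\<dots> \<le> exp (h ^ 3 / 6 * third_cumulant t) - 1"
    using \<phi> third_cumulant_nonneg[OF t] by (simp add: mult_right_mono power_mono)
  finally show ?thesis .
qed

lemma cmod_char_normalized:
  assumes "0 \<le> t"
  shows "cmod (char (khinchin_normalized f t) \<theta>) = exp (- (eval_fps g t -
    Re (eval_fps (complex_fps g) (of_real t * iexp (\<theta> / khinchin_sd f t)))))"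
  by (simp add: char_khinchin_normalized[OF assms])

section \<open>A criterion for the Hayman class\<close>

text \<open>The first supremum is at most \<open>exp (h^3 D^3 g / 6) - 1\<close>, the second at most
  \<open>exp (-c)\<close>, where \<open>c\<close> bounds the decay exponent uniformly on the outer
  arc.\<close>

lemma hayman_classI:
  assumes h: "\<And>t. 0 \<le> t \<Longrightarrow> 0 < h t \<and> h t \<le> pi"
    and major: "((\<lambda>t. h t ^ 3 * third_cumulant t) \<longlongrightarrow> 0) at_top"
    and minor: "\<And>t \<phi>. 0 \<le> t \<Longrightarrow> h t \<le> \<bar>\<phi>\<bar> \<Longrightarrow> \<bar>\<phi>\<bar> \<le> pi \<Longrightarrow>
      c t \<le> eval_fps g t - Re (eval_fps (complex_fps g) (of_real t * iexp \<phi>))"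
    and minor_lim: "((\<lambda>t. khinchin_sd f t * exp (- c t)) \<longlongrightarrow> 0) at_top"
  shows "hayman_class f"
proof -
  have sd_pos: "0 < khinchin_sd f t" if "0 < t" for t
    using sqrt_le_khinchin_sd[of t] that g_1_pos
    by (meson less_le_trans less_imp_le mult_pos_pos real_sqrt_gt_zero)
  have sd_lim: "filterlim (khinchin_sd f) at_top at_top"
  proof (rule filterlim_at_top_mono)
    show "filterlim (\<lambda>t. sqrt (fps_nth g 1 * t)) at_top at_top"
      using g_1_pos by real_asymp
    show "\<forall>\<^sub>F t in at_top. sqrt (fps_nth g 1 * t) \<le> khinchin_sd f t"
      using eventually_ge_at_top[of 0] by eventually_elim (rule sqrt_le_khinchin_sd)
  qed
  have lim1: "((\<lambda>t. SUP \<theta> \<in> {\<theta>. \<bar>\<theta>\<bar> \<le> h t * khinchin_sd f t}.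
      cmod (char (khinchin_normalized f t) \<theta> * complex_of_real (exp (\<theta>\<^sup>2 / 2)) - 1))
      \<longlongrightarrow> 0) at_top" (is "((\<lambda>t. ?S t) \<longlongrightarrow> 0) at_top")
  proof (rule tendsto_sandwich[OF _ _ tendsto_const])
    have "\<forall>\<^sub>F t in at_top. 0 \<le> ?S t \<and> ?S t \<le> exp (h t ^ 3 / 6 * third_cumulant t) - 1"
      using eventually_gt_at_top[of 0]
    proof eventually_elim
      case (elim t)
      then have "0 \<in> {\<theta>. \<bar>\<theta>\<bar> \<le> h t * khinchin_sd f t}"
        using h[of t] sd_pos[of t] by simp
      then have ne: "{\<theta>. \<bar>\<theta>\<bar> \<le> h t * khinchin_sd f t} \<noteq> {}" by blast
      show ?case
        using elim sd_pos[of t]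
        by (intro conjI cSUP_nonneg_le[OF ne]) (use char_normalized_approx[of t] in simp_all)
    qed
    then show "\<forall>\<^sub>F t in at_top. 0 \<le> ?S t"
      "\<forall>\<^sub>F t in at_top. ?S t \<le> exp (h t ^ 3 / 6 * third_cumulant t) - 1"
      by (simp_all add: eventually_conj_iff)
    have "((\<lambda>t. exp (h t ^ 3 * third_cumulant t / 6) - 1) \<longlongrightarrow> exp (0 / 6) - 1) at_top"
      by (intro tendsto_intros major) auto
    then show "((\<lambda>t. exp (h t ^ 3 / 6 * third_cumulant t) - 1) \<longlongrightarrow> 0) at_top"
      by simp
  qed
  have lim2: "((\<lambda>t. khinchin_sd f t *
      (SUP \<theta> \<in> {\<theta>. h t * khinchin_sd f t \<le> \<bar>\<theta>\<bar> \<and> \<bar>\<theta>\<bar> \<le> pi * khinchin_sd f t}.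
         cmod (char (khinchin_normalized f t) \<theta>))) \<longlongrightarrow> 0) at_top"
    (is "((\<lambda>t. _ * ?S t) \<longlongrightarrow> 0) at_top")
  proof (rule tendsto_sandwich[OF _ _ tendsto_const minor_lim])
    have "\<forall>\<^sub>F t in at_top. 0 \<le> ?S t \<and> ?S t \<le> exp (- c t) \<and> 0 \<le> khinchin_sd f t"
      using eventually_gt_at_top[of 0]
    proof eventually_elim
      case (elim t)
      then have "pi * khinchin_sd f t \<in>
          {\<theta>. h t * khinchin_sd f t \<le> \<bar>\<theta>\<bar> \<and> \<bar>\<theta>\<bar> \<le> pi * khinchin_sd f t}"
        using h[of t] sd_pos[of t] by (simp add: abs_mult)
      then have ne: "{\<theta>. h t * khinchin_sd f t \<le> \<bar>\<theta>\<bar> \<and> \<bar>\<theta>\<bar> \<le> pi * khinchin_sd f t} \<noteq> {}"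
        by blast
      \<comment> \<open>Rescaling by the positive standard deviation turns the range of
        \<open>\<theta>\<close> into \<open>h t \<le> |\<phi>| \<le> pi\<close>.\<close>
      have "cmod (char (khinchin_normalized f t) \<theta>) \<le> exp (- c t)"
        if "h t * khinchin_sd f t \<le> \<bar>\<theta>\<bar>" "\<bar>\<theta>\<bar> \<le> pi * khinchin_sd f t" for \<theta>
        using minor[of t "\<theta> / khinchin_sd f t"] that elim sd_pos[of t]
        by (simp add: cmod_char_normalized field_simps)
      then show ?case
        using elim sd_pos[of t] by (intro conjI cSUP_nonneg_le[OF ne]) auto
    qed
    then show "\<forall>\<^sub>F t in at_top. 0 \<le> khinchin_sd f t * ?S t"
      "\<forall>\<^sub>F t in at_top. khinchin_sd f t * ?S t \<le> khinchin_sd f t * exp (- c t)"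
      by (auto elim!: eventually_mono intro: mult_left_mono mult_nonneg_nonneg)
  qed
  \<comment> \<open>The radius is infinite, so the limit filter is \<open>at_top\<close>.\<close>
  show ?thesis
    unfolding hayman_class_def f_radius at_left_ereal_def
    using khinchin_series_f h lim1 lim2 sd_lim by (intro conjI exI[of _ h]) auto
qed

end

section \<open>Growth estimates\<close>

text \<open>The sequence \<open>n^3 (a/b)^n\<close> tends to 0 and is therefore bounded. This
  absorbs the factor \<open>n^3\<close> of the third cumulant into a slightly larger base.\<close>

lemma cube_times_power_le:
  fixes a b :: real
  assumes "0 < a" "a < b"
  obtains C where "0 < C" "\<And>n. real n ^ 3 * a ^ n \<le> C * b ^ n"
proof -
  define r where "r = a / b"
  have r: "0 < r" "r < 1" using assms by (auto simp: r_def)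
  have "(\<lambda>n. real n ^ 3 * r ^ n) \<longlonglongrightarrow> 0"
    using r by real_asymp
  then have "Bseq (\<lambda>n. real n ^ 3 * r ^ n)"
    by (intro convergent_imp_Bseq convergentI)
  then obtain C where C: "0 < C" "\<And>n. norm (real n ^ 3 * r ^ n) \<le> C"
    unfolding Bseq_def by blast
  have "real n ^ 3 * a ^ n \<le> C * b ^ n" for n
  proof -
    have "real n ^ 3 * r ^ n * b ^ n \<le> C * b ^ n"
      using C(2)[of n] assms by (intro mult_right_mono) auto
    then show ?thesis using assms by (simp add: r_def power_divide)
  qed
  with C(1) show thesis by (rule that)
qed

text \<open>As \<open>1 - cos h\<close> is asymptotic to \<open>h^2 / 2\<close>, the exponent is of
  order \<open>t e^((\<beta> - 2\<gamma>)t)\<close>; the resulting doubly exponential decay beats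
  the simply exponential factor.\<close>

lemma sqrt_exp_times_double_exp_tendsto_0:
  fixes B C a \<beta> \<gamma> :: real
  assumes "0 < B" "0 < C" "0 < a" "0 < \<gamma>" "2 * \<gamma> < \<beta>"
  shows "((\<lambda>t. sqrt (C * exp (a * t)) *
    exp (- (B * (exp (\<beta> * t) - exp (\<beta> * t * cos (exp (- \<gamma> * t))))))) \<longlongrightarrow> 0) at_top"
proof (rule tendsto_sandwich[OF _ _ tendsto_const])
  define \<delta> K where "\<delta> = \<beta> - 2 * \<gamma>" and "K = B * \<beta> / 4"
  have pos: "0 < \<delta>" "0 < K" using assms by (auto simp: \<delta>_def K_def)
  show "((\<lambda>t. sqrt (C * exp (a * t)) * exp (- (K * t * exp (\<delta> * t)))) \<longlongrightarrow> 0) at_top"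
    using assms(2,3) pos by real_asymp
  have "0 < \<beta>" using assms by linarith
  \<comment> \<open>The right side is asymptotic to \<open>(\<beta> / 2) t e^(-2\<gamma>t)\<close>;
    the constant \<open>\<beta> / 4\<close> leaves slack for an eventual inequality.\<close>
  with \<open>0 < \<gamma>\<close> have "\<forall>\<^sub>F t in at_top. t * exp (- 2 * \<gamma> * t) * (\<beta> / 4) \<le>
      1 - exp (\<beta> * t * (cos (exp (- \<gamma> * t)) - 1))"
    by real_asymp
  then show "\<forall>\<^sub>F t in at_top. sqrt (C * exp (a * t)) *
      exp (- (B * (exp (\<beta> * t) - exp (\<beta> * t * cos (exp (- \<gamma> * t)))))) \<le>
      sqrt (C * exp (a * t)) * exp (- (K * t * exp (\<delta> * t)))"
  proof eventually_elim
    case (elim t)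
    have "K * t * exp (\<delta> * t) = B * exp (\<beta> * t) * (t * exp (- 2 * \<gamma> * t) * (\<beta> / 4))"
      by (simp add: K_def \<delta>_def left_diff_distrib exp_diff exp_minus field_simps)
    also have "\<dots> \<le> B * exp (\<beta> * t) * (1 - exp (\<beta> * t * (cos (exp (- \<gamma> * t)) - 1)))"
      using elim assms(1) by (intro mult_left_mono) auto
    also have "\<dots> = B * (exp (\<beta> * t) - exp (\<beta> * t * cos (exp (- \<gamma> * t))))"
      by (simp add: right_diff_distrib exp_diff)
    finally show ?case
      using assms(2) by (intro mult_left_mono) auto
  qed
qed (use assms(2) in auto)

section \<open>Choice of parameters and verification of the criterion\<close>

theorem theorem5p4:
  fixes f g :: "real fps" and B L \<beta> lam :: real
  assumes "\<And>n. 0 \<le> fps_nth g n"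
    and "0 < B" and "0 < L" and "0 \<le> \<beta>" and "0 \<le> lam" and "2 * lam < 3 * \<beta>"
    and "\<And>n. 1 \<le> n \<Longrightarrow> B * (\<beta> ^ n / fact n) \<le> fps_nth g n"
    and "\<And>n. 1 \<le> n \<Longrightarrow> fps_nth g n \<le> L * (lam ^ n / fact n)"
    and "(\<lambda>x. exp (eval_fps g x)) has_fps_expansion f"
  shows "hayman_class f"
proof -
  note lower = assms(7) and upper = assms(8)
  have \<beta>: "0 < \<beta>" using assms by linarith
  then have g1: "0 < fps_nth g 1"
    using lower[of 1] assms(2) by (smt (verit) fact_1 mult_pos_pos div_by_1 power_one_right order_refl)
  \<comment> \<open>If \<open>lam\<close> were 0, the upper bound at \<open>n = 1\<close> would
    contradict \<open>g1\<close>.\<close>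
  have lam: "0 < lam"
    using upper[of 1] g1 assms(3,5) by (cases "lam = 0") auto
  have radius: "fps_conv_radius g = \<infinity>"
    unfolding fps_conv_radius_def
  proof (rule conv_radius_inftyI'')
    fix z :: real
    \<comment> \<open>The majorant is an exponential series. The coefficient bounds start at
      \<open>n = 1\<close>, so the comparison is only eventual.\<close>
    have "summable (\<lambda>n. L * (norm (lam * z) ^ n /\<^sub>R fact n))"
      by (intro summable_mult summable_exp_generic)
    then show "summable (\<lambda>n. fps_nth g n * z ^ n)"
    proof (rule summable_comparison_test_ev[rotated])
      show "\<forall>\<^sub>F n in sequentially. norm (fps_nth g n * z ^ n) \<le> L * (norm (lam * z) ^ n /\<^sub>R fact n)"
        using eventually_ge_at_top[of 1]
      proof eventually_elim
        case (elim n)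
        have "norm (fps_nth g n * z ^ n) = fps_nth g n * \<bar>z\<bar> ^ n"
          using assms(1) by (simp add: abs_mult power_abs)
        also have "\<dots> \<le> L * (lam ^ n / fact n) * \<bar>z\<bar> ^ n"
          using upper[OF elim] by (intro mult_right_mono) auto
        finally show ?case
          using lam by (simp add: abs_mult power_mult_distrib field_simps)
      qed
    qed
  qed
  interpret entire_exp f g
    using assms(1,9) radius g1 by unfold_locales auto
  \<comment> \<open>Enlarging \<open>lam\<close> to \<open>l\<close> pays for the factor
    \<open>n^3\<close> while keeping the strict inequality against \<open>3\<beta>\<close>.\<close>
  obtain l where l: "lam < l" "2 * l < 3 * \<beta>"
    using dense[of lam "3 * \<beta> / 2"] assms(6) by auto
  \<comment> \<open>The lower bound on \<open>\<gamma>\<close> makes \<open>h^3 D^3 g\<close> vanish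
    in the limit; the upper bound keeps the exponent \<open>\<beta> - 2\<gamma>\<close> on the outer
    arc positive.\<close>
  obtain \<gamma> where \<gamma>: "l / 3 < \<gamma>" "\<gamma> < \<beta> / 2"
    using dense[of "l / 3" "\<beta> / 2"] l by auto
  obtain C where C: "0 < C" "\<And>n. real n ^ 3 * lam ^ n \<le> C * l ^ n"
    using cube_times_power_le[OF lam l(1)] by metis
  have third_le: "third_cumulant t \<le> L * C * exp (l * t)" if t: "0 \<le> t" for t
  proof (rule sums_le)
    show "(\<lambda>n. fps_nth (fps_XD (fps_XD (fps_XD g))) n * t ^ n) sums third_cumulant t"
      by (intro sums_eval_fps) (simp add: fps_conv_radius_XD_infinity radius)
    show "(\<lambda>n. L * C * ((l * t) ^ n /\<^sub>R fact n)) sums (L * C * exp (l * t))"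
      by (intro sums_mult exp_converges)
    show "fps_nth (fps_XD (fps_XD (fps_XD g))) n * t ^ n \<le> L * C * ((l * t) ^ n /\<^sub>R fact n)" for n
    \<comment> \<open>At \<open>n = 0\<close>, where \<open>upper\<close> is silent, the operator
      \<open>D\<close> has annihilated the coefficient.\<close>
    proof (cases "n = 0")
      case False
      have "fps_nth (fps_XD (fps_XD (fps_XD g))) n * t ^ n = real n ^ 3 * t ^ n * fps_nth g n"
        by (simp add: numeral_3_eq_3)
      also have "\<dots> \<le> real n ^ 3 * t ^ n * (L * (lam ^ n / fact n))"
        using False t by (intro mult_left_mono upper) auto
      also have "\<dots> = L * t ^ n / fact n * (real n ^ 3 * lam ^ n)"
        by simp
      also have "\<dots> \<le> L * t ^ n / fact n * (C * l ^ n)"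
        using assms(3) t by (intro mult_left_mono C) auto
      finally show ?thesis by (simp add: power_mult_distrib field_simps)
    qed (use assms(3) C(1) in simp)
  qed
  show ?thesis
  \<comment> \<open>The goals below fix \<open>h t\<close> as \<open>exp (- \<gamma> * t)\<close>
    and \<open>c t\<close> as
    \<open>B * (exp (\<beta> * t) - exp (\<beta> * t * cos (h t)))\<close>.\<close>
  proof (rule hayman_classI)
    fix t :: real assume "0 \<le> t"
    then have "exp (- \<gamma> * t) \<le> 1" using \<gamma> l lam by simp
    then show "0 < exp (- \<gamma> * t) \<and> exp (- \<gamma> * t) \<le> pi"
      using pi_gt3 by (smt (verit) exp_gt_zero)
  next
    show "((\<lambda>t. exp (- \<gamma> * t) ^ 3 * third_cumulant t) \<longlongrightarrow> 0) at_top"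
    proof (rule tendsto_sandwich[OF _ _ tendsto_const])
      show "\<forall>\<^sub>F t in at_top. 0 \<le> exp (- \<gamma> * t) ^ 3 * third_cumulant t"
        using eventually_ge_at_top[of 0] by eventually_elim (simp add: third_cumulant_nonneg)
      show "\<forall>\<^sub>F t in at_top. exp (- \<gamma> * t) ^ 3 * third_cumulant t \<le> L * C * exp (- (3 * \<gamma> - l) * t)"
        using eventually_ge_at_top[of 0]
      proof eventually_elim
        case (elim t)
        have "exp (- \<gamma> * t) ^ 3 * third_cumulant t \<le> exp (- \<gamma> * t) ^ 3 * (L * C * exp (l * t))"
          using third_le[OF elim] by (intro mult_left_mono) auto
        then show ?case
          by (simp add: algebra_simps flip: exp_of_nat_mult exp_add)
      qed
      have "0 < 3 * \<gamma> - l" using \<gamma> by simp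
      then show "((\<lambda>t. L * C * exp (- (3 * \<gamma> - l) * t)) \<longlongrightarrow> 0) at_top"
        by real_asymp
    qed
  next
    fix t \<phi> :: real
    assume t: "0 \<le> t" and \<phi>: "exp (- \<gamma> * t) \<le> \<bar>\<phi>\<bar>" "\<bar>\<phi>\<bar> \<le> pi"
    have E: "complex_fps (fps_exp \<beta>) = fps_exp (of_real \<beta>)"
      by (simp add: fps_eq_iff)
    \<comment> \<open>The comparison series is \<open>B e^(\<beta>z)\<close>, whose coefficients are
      the assumed lower bounds for those of \<open>g\<close>.\<close>
    have "B * (exp (\<beta> * t) - exp (\<beta> * t * cos (exp (- \<gamma> * t)))) \<le>
        B * (exp (\<beta> * t) - Re (exp (of_real (\<beta> * t) * iexp \<phi>)))"
      using assms(2) \<beta> t \<phi> by (intro mult_left_mono exp_minus_Re_exp_ge) auto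
    also have "\<dots> \<le> eval_fps g t - Re (eval_fps (complex_fps g) (of_real t * iexp \<phi>))"
    proof (rule sums_le)
      show "(\<lambda>n. B * (fps_nth (fps_exp \<beta>) n * t ^ n * (1 - cos (real n * \<phi>)))) sums
          (B * (exp (\<beta> * t) - Re (exp (of_real (\<beta> * t) * iexp \<phi>))))"
        using sums_mult[OF sums_eval_fps_minus_Re_eval_fps[of "fps_exp \<beta>" t \<phi>], of B]
        by (simp add: E mult.assoc)
      show "(\<lambda>n. fps_nth g n * t ^ n * (1 - cos (real n * \<phi>))) sums
          (eval_fps g t - Re (eval_fps (complex_fps g) (of_real t * iexp \<phi>)))"
        by (rule sums_eval_fps_minus_Re_eval_fps[OF radius])
      show "B * (fps_nth (fps_exp \<beta>) n * t ^ n * (1 - cos (real n * \<phi>))) \<le>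
          fps_nth g n * t ^ n * (1 - cos (real n * \<phi>))" for n
      \<comment> \<open>The constant terms, on which \<open>lower\<close> says nothing, carry the
        weight \<open>1 - cos 0 = 0\<close>.\<close>
      proof (cases "n = 0")
        case False
        then have "B * (\<beta> ^ n / fact n) * (t ^ n * (1 - cos (real n * \<phi>))) \<le>
            fps_nth g n * (t ^ n * (1 - cos (real n * \<phi>)))"
          using t by (intro mult_right_mono lower) auto
        then show ?thesis by (simp add: mult.assoc)
      qed simp
    qed
    finally show "B * (exp (\<beta> * t) - exp (\<beta> * t * cos (exp (- \<gamma> * t)))) \<le>
        eval_fps g t - Re (eval_fps (complex_fps g) (of_real t * iexp \<phi>))" .
  next
    show "((\<lambda>t. khinchin_sd f t *
        exp (- (B * (exp (\<beta> * t) - exp (\<beta> * t * cos (exp (- \<gamma> * t))))))) \<longlongrightarrow> 0) at_top"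
    proof (rule tendsto_sandwich[OF _ _ tendsto_const])
      show "\<forall>\<^sub>F t in at_top. 0 \<le> khinchin_sd f t *
          exp (- (B * (exp (\<beta> * t) - exp (\<beta> * t * cos (exp (- \<gamma> * t))))))"
        using eventually_ge_at_top[of 0]
        by eventually_elim (simp add: khinchin_sd_eq eval_XD_XD_nonneg)
      show "\<forall>\<^sub>F t in at_top. khinchin_sd f t *
          exp (- (B * (exp (\<beta> * t) - exp (\<beta> * t * cos (exp (- \<gamma> * t)))))) \<le>
          sqrt (L * C * exp (l * t)) *
          exp (- (B * (exp (\<beta> * t) - exp (\<beta> * t * cos (exp (- \<gamma> * t))))))"
        using eventually_ge_at_top[of 0]
      proof eventually_elim
        case (elim t)
        \<comment> \<open>The chain is
          \<open>\<sigma>^2 = D^2 g \<le> D^3 g \<le> L C e^(lt)\<close>.\<close>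
        have "khinchin_sd f t \<le> sqrt (L * C * exp (l * t))"
          using eval_XD_XD_le_third_cumulant[OF elim] third_le[OF elim]
          by (simp add: khinchin_sd_eq elim)
        then show ?case by (intro mult_right_mono) auto
      qed
      show "((\<lambda>t. sqrt (L * C * exp (l * t)) *
          exp (- (B * (exp (\<beta> * t) - exp (\<beta> * t * cos (exp (- \<gamma> * t))))))) \<longlongrightarrow> 0) at_top"
        using assms(2,3) C \<gamma> l lam by (intro sqrt_exp_times_double_exp_tendsto_0) auto
    qed
  qed
qed

end
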